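(* Let $s\in(0,1)$ and let $\Omega\subseteq\mathbb{R}^n$ be a bounded open set with boundary of class $C^1$. Let $c_0\in\mathbb{R}$ and $\overline\varepsilon\in(0,1)$. Let $u\in C_b(\mathbb{R}^n)\cap C^2(\overline\Omega)$ be such that $\mathcal{L}u\ge0$ pointwise in $\Omega$. Let $\xi\in\partial\Omega$, and assume that $u=c_0$ on $B_{\overline\varepsilon}(\xi)\cap\partial\Omega$, that $u\ge c_0$ in $\mathbb{R}^n$, that $u\not\equiv c_0$, and that $B_{\overline\varepsilon}(\xi)\cap\partial\Omega$ is of class $C^2$. Let $\nu$ be the outer unit normal to $\partial\Omega$ at $\xi$. Then $\partial_\nu u(\xi)<0$.
   Context: $C_b(\mathbb{R}^n):=C(\mathbb{R}^n)\cap L^\infty(\mathbb{R}^n)$. The operator is $\mathcal{L}=-\Delta+(-\Delta)^s$, computed pointwise, where $$(-\Delta)^s u(x):=\frac12\int_{\mathbb{R}^n}\frac{2u(x)-u(x+y)-u(x-y)}{|y|^{n+2s}}\,dy .$$ $B_r(\xi)$ denotes the open ball of radius $r$ centred at $\xi$. *)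

theory Defs
  imports "HOL-Analysis.Analysis"
begin

definition C1_fun :: "('a::euclidean_space \<Rightarrow> real) \<Rightarrow> bool" where
  "C1_fun g \<longleftrightarrow> (\<exists>G. (\<forall>x. (g has_derivative (\<lambda>h. G x \<bullet> h)) (at x)) \<and> continuous_on UNIV G)"

definition C2_fun :: "('a::euclidean_space \<Rightarrow> real) \<Rightarrow> bool" where
  "C2_fun g \<longleftrightarrow> (\<exists>G. (\<forall>x. (g has_derivative (\<lambda>h. G x \<bullet> h)) (at x)) \<and>
                      (\<forall>i\<in>Basis. C1_fun (\<lambda>x. G x \<bullet> i)))"

definition C2_closure :: "('a::euclidean_space \<Rightarrow> real) \<Rightarrow> 'a set \<Rightarrow> bool" where
  "C2_closure u \<Omega> \<longleftrightarrow> (\<exists>G H.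
      (\<forall>x\<in>\<Omega>. (u has_derivative (\<lambda>h. G x \<bullet> h)) (at x)) \<and>
      (\<forall>x\<in>\<Omega>. \<forall>i\<in>Basis. ((\<lambda>y. G y \<bullet> i) has_derivative (\<lambda>h. H x i \<bullet> h)) (at x)) \<and>
      continuous_on (closure \<Omega>) G \<and>
      (\<forall>i\<in>Basis. continuous_on (closure \<Omega>) (\<lambda>x. H x i)))"

definition bdry_graph :: "('a::euclidean_space \<Rightarrow> real) \<Rightarrow> 'a set \<Rightarrow> 'a \<Rightarrow> 'a \<Rightarrow> real \<Rightarrow> bool" where
  "bdry_graph g \<Omega> p e r \<longleftrightarrow> norm e = 1 \<and> r > 0 \<and>
     \<Omega> \<inter> ball p r = {x \<in> ball p r. x \<bullet> e < g (x - (x \<bullet> e) *\<^sub>R e)}"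

definition C1_boundary :: "'a::euclidean_space set \<Rightarrow> bool" where
  "C1_boundary \<Omega> \<longleftrightarrow> (\<forall>p\<in>frontier \<Omega>. \<exists>g e r. C1_fun g \<and> bdry_graph g \<Omega> p e r)"

definition C2_boundary_on :: "'a::euclidean_space set \<Rightarrow> 'a set \<Rightarrow> bool" where
  "C2_boundary_on \<Omega> S \<longleftrightarrow> (\<forall>p\<in>S. \<exists>g e r. C2_fun g \<and> bdry_graph g \<Omega> p e r)"

text \<open>Outer unit normal at xi: normalized gradient of the local defining function
  phi(x) = x.e - g(projection of x), where Omega = {phi < 0} near xi.\<close>
definition outer_unit_normal :: "'a::euclidean_space set \<Rightarrow> 'a \<Rightarrow> 'a \<Rightarrow> bool" where
  "outer_unit_normal \<Omega> \<xi> \<nu> \<longleftrightarrow> (\<exists>g e r N. C1_fun g \<and> bdry_graph g \<Omega> \<xi> e r \<and>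
      ((\<lambda>x. x \<bullet> e - g (x - (x \<bullet> e) *\<^sub>R e)) has_derivative (\<lambda>h. N \<bullet> h)) (at \<xi>) \<and>
      \<nu> = N /\<^sub>R norm N)"

definition partial_deriv :: "('a::euclidean_space \<Rightarrow> real) \<Rightarrow> 'a \<Rightarrow> 'a \<Rightarrow> real" where
  "partial_deriv u i x = deriv (\<lambda>t. u (x + t *\<^sub>R i)) 0"

definition laplacian :: "('a::euclidean_space \<Rightarrow> real) \<Rightarrow> 'a \<Rightarrow> real" where
  "laplacian u x = (\<Sum>i\<in>Basis. partial_deriv (partial_deriv u i) i x)"

definition frac_laplacian :: "real \<Rightarrow> ('a::euclidean_space \<Rightarrow> real) \<Rightarrow> 'a \<Rightarrow> real" where
  "frac_laplacian s u x = (1/2) * (\<integral>y. (2 * u x - u (x + y) - u (x - y)) /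
                                        norm y powr (real DIM('a) + 2 * s) \<partial>lborel)"

definition mixed_op :: "real \<Rightarrow> ('a::euclidean_space \<Rightarrow> real) \<Rightarrow> 'a \<Rightarrow> real" where
  "mixed_op s u x = - laplacian u x + frac_laplacian s u x"

end

theory Submission
  imports Defs
begin

text \<open>
  Both halves of the argument rest on one estimate. Suppose that the second difference
  \<open>2 u(x) - u(x+y) - u(x-y)\<close> is at most \<open>2 \<delta> |y|\<^sup>2\<close>, that \<open>c \<le> u\<close> everywhere with
  \<open>u(x) \<le> c + \<delta>\<close>, and that \<open>u \<ge> c + m\<close> on some ball. Then the local part and the singular part of the
  operator contribute at most a multiple of \<open>\<delta>\<close>, whereas the ball contributes a fixed negative
  multiple of \<open>m\<close> through the nonlocal term; so the operator is negative at \<open>x\<close> once \<open>\<delta>\<close> is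
  small compared with \<open>m\<close>.

  With \<open>\<delta> = 0\<close> this is the strong maximum principle: \<open>u > c\<^sub>0\<close> in \<open>\<Omega>\<close>, without any connectedness.
  For the boundary derivative, take an interior ball \<open>B\<^sub>R(x\<^sub>0)\<close> touching at \<open>\<xi>\<close>. If
  \<open>u - c\<^sub>0 - \<delta> (R\<^sup>2 - |x - x\<^sub>0|\<^sup>2)\<close> had a negative value, the estimate at its minimum, with the bump
  on \<open>B\<^bsub>R/2\<^esub>(x\<^sub>0)\<close>, would contradict \<open>L u \<ge> 0\<close>. Hence \<open>u\<close> lies above a paraboloid with
  negative outer normal derivative at \<open>\<xi>\<close>.
\<close>

section \<open>Integrability of the truncated fractional kernel\<close>

text \<open>The kernel is dominated by a sum of weighted indicators of dyadic balls; the two geometric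
  series (towards \<open>0\<close> and towards infinity) have ratios \<open>2 powr (2s - 2)\<close> and \<open>2 powr (-2s)\<close>.\<close>
lemma fractional_kernel_integrable:
  fixes s :: real
  assumes s: "0 < s" "s < 1"
  shows "integrable lborel (\<lambda>y::'a::euclidean_space.
           min ((norm y)\<^sup>2) 1 / norm y powr (real DIM('a) + 2 * s))"
proof -
  define n where "n = DIM('a)"
  define p where "p = real n + 2 * s"
  define V where "V = unit_ball_vol (real n)"
  define F :: "'a \<Rightarrow> real" where "F y = min ((norm y)\<^sup>2) 1 / norm y powr p" for y
  \<comment> \<open>\<open>a k\<close> bounds \<open>F\<close> on the shell
    \<open>2 powr (-k-1) \<le> norm y < 2 powr (-k)\<close>, and \<open>b k\<close> on the shell
    \<open>2 powr k \<le> norm y < 2 powr (k+1)\<close>. The weights are spread over full balls,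
    whose volume has a closed form; this costs only a constant factor.\<close>
  define a :: "nat \<Rightarrow> real" where "a k = 2 powr p * 2 powr (real k * (p - 2))" for k
  define b :: "nat \<Rightarrow> real" where "b k = 2 powr (- (real k * p))" for k
  define \<alpha> :: "nat \<Rightarrow> 'a \<Rightarrow> ennreal"
    where "\<alpha> k y = ennreal (a k) * indicator (ball 0 (2 powr (- real k))) y" for k y
  define \<beta> :: "nat \<Rightarrow> 'a \<Rightarrow> ennreal"
    where "\<beta> k y = ennreal (b k) * indicator (ball 0 (2 powr (real k + 1))) y" for k y
  have p: "p > 0" "n > 0" using s by (auto simp: p_def n_def intro: add_nonneg_pos)
  have V: "V \<ge> 0" by (simp add: V_def unit_ball_vol_def)
  have ab: "a k \<ge> 0" "b k \<ge> 0" for k by (auto simp: a_def b_def)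
  have ptw: "ennreal (F y) \<le> (\<Sum>k. \<alpha> k y) + (\<Sum>k. \<beta> k y)" for y
  proof (cases "y = 0")
    case True
    then show ?thesis by (simp add: F_def)
  next
    case False
    then have ny: "norm y > 0" by simp
    define j where "j = \<lfloor>log 2 (norm y)\<rfloor>"
    have "real_of_int j \<le> log 2 (norm y)" "log 2 (norm y) < j + 1"
      unfolding j_def by linarith+
    then have jl: "2 powr j \<le> norm y" and ju: "norm y < 2 powr (j + 1)"
      using ny by (simp_all add: le_log_iff log_less_iff)
    have jp: "2 powr (j * p) \<le> norm y powr p"
      using powr_mono2[OF less_imp_le[OF p(1)] _ jl] by (simp add: powr_powr)
    show ?thesis
    proof (cases "j \<ge> 0")
      case True
      then obtain k where k: "j = int k" using nonneg_int_cases by blast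
      have "F y \<le> 1 / norm y powr p"
        unfolding F_def by (intro divide_right_mono) auto
      also have "\<dots> \<le> 1 / 2 powr (j * p)"
        using jp by (intro divide_left_mono) (use ny in auto)
      also have "\<dots> = b k" by (simp add: b_def k powr_minus_divide)
      finally have "ennreal (F y) \<le> \<beta> k y"
        using ju by (simp add: \<beta>_def k ennreal_leI)
      also have "\<dots> \<le> (\<Sum>k. \<beta> k y)"
        using sum_le_suminf[of "\<lambda>k. \<beta> k y" "{k}"] by simp
      also have "\<dots> \<le> (\<Sum>k. \<alpha> k y) + (\<Sum>k. \<beta> k y)" by simp
      finally show ?thesis .
    next
      case False
      \<comment> \<open>The shift by one makes the outer radius \<open>2 powr (j + 1)\<close> equal
        to \<open>2 powr (- k)\<close>, so that \<open>j = -1\<close> corresponds to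
        \<open>k = 0\<close>.\<close>
      define k where "k = nat (- j - 1)"
      have k: "real_of_int j = - real k - 1" using False by (simp add: k_def)
      have "norm y \<le> 2 powr (- real k)" using ju k by simp
      then have "(norm y)\<^sup>2 \<le> (2 powr (- real k))\<^sup>2" by (intro power_mono) auto
      also have "\<dots> = 2 powr (- (2 * real k))"
        by (simp add: powr_realpow[symmetric] powr_powr mult.commute)
      finally have "F y \<le> 2 powr (- (2 * real k)) / norm y powr p"
        unfolding F_def by (intro divide_right_mono) auto
      also have "\<dots> \<le> 2 powr (- (2 * real k)) / 2 powr (j * p)"
        using jp by (intro divide_left_mono) (use ny in auto)
      also have "\<dots> = a k"
        by (simp add: a_def k powr_diff[symmetric] powr_add[symmetric] algebra_simps)
      finally have "ennreal (F y) \<le> \<alpha> k y"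
        using ju by (simp add: \<alpha>_def k ennreal_leI)
      also have "\<dots> \<le> (\<Sum>k. \<alpha> k y)"
        using sum_le_suminf[of "\<lambda>k. \<alpha> k y" "{k}"] by simp
      also have "\<dots> \<le> (\<Sum>k. \<alpha> k y) + (\<Sum>k. \<beta> k y)" by simp
      finally show ?thesis .
    qed
  qed
  have [measurable]: "\<alpha> k \<in> borel_measurable borel" "\<beta> k \<in> borel_measurable borel" for k
    unfolding \<alpha>_def[abs_def] \<beta>_def[abs_def]
    by (auto intro!: borel_measurable_times_ennreal borel_measurable_indicator)
  have vol: "emeasure lborel (ball (0::'a) \<rho>) = ennreal (V * \<rho> ^ n)" if "\<rho> \<ge> 0" for \<rho>
    using that by (simp add: emeasure_ball V_def n_def)
  have int_\<alpha>: "(\<integral>\<^sup>+y. \<alpha> k y \<partial>lborel) = ennreal (2 powr p * V * (2 powr (2 * s - 2)) ^ k)" for k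
  proof -
    have "(\<integral>\<^sup>+y. \<alpha> k y \<partial>lborel) = ennreal (a k) * ennreal (V * (2 powr (- real k)) ^ n)"
      unfolding \<alpha>_def by (subst nn_integral_cmult_indicator) (auto simp: vol)
    also have "\<dots> = ennreal (a k * (V * (2 powr (- real k)) ^ n))"
      by (simp add: ennreal_mult' ab V)
    also have "a k * (V * (2 powr (- real k)) ^ n) = 2 powr p * V * (2 powr (2 * s - 2)) ^ k"
      by (simp add: a_def p_def powr_realpow[symmetric] powr_powr powr_add[symmetric] algebra_simps)
    finally show ?thesis .
  qed
  have int_\<beta>: "(\<integral>\<^sup>+y. \<beta> k y \<partial>lborel) = ennreal (2 powr n * V * (2 powr (- 2 * s)) ^ k)" for k
  proof -
    have "(\<integral>\<^sup>+y. \<beta> k y \<partial>lborel) = ennreal (b k) * ennreal (V * (2 powr (real k + 1)) ^ n)"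
      unfolding \<beta>_def by (subst nn_integral_cmult_indicator) (auto simp: vol)
    also have "\<dots> = ennreal (b k * (V * (2 powr (real k + 1)) ^ n))"
      by (simp add: ennreal_mult' ab V)
    also have "b k * (V * (2 powr (real k + 1)) ^ n) = 2 powr n * V * (2 powr (- 2 * s)) ^ k"
      by (simp add: b_def p_def powr_realpow[symmetric] powr_powr powr_add[symmetric] algebra_simps)
    finally show ?thesis .
  qed
  have "(\<integral>\<^sup>+y. ennreal (F y) \<partial>lborel) \<le> (\<integral>\<^sup>+y. (\<Sum>k. \<alpha> k y) + (\<Sum>k. \<beta> k y) \<partial>lborel)"
    by (intro nn_integral_mono ptw)
  also have "\<dots> = (\<Sum>k. \<integral>\<^sup>+y. \<alpha> k y \<partial>lborel) + (\<Sum>k. \<integral>\<^sup>+y. \<beta> k y \<partial>lborel)"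
    by (simp add: nn_integral_add nn_integral_suminf)
  also have "\<dots> < \<infinity>"
  proof -
    have "2 powr (2 * s - 2) < (1::real)" "2 powr (- 2 * s) < (1::real)"
      using s by (simp_all add: powr_less_one)
    then have "summable (\<lambda>k. 2 powr p * V * (2 powr (2 * s - 2)) ^ k)"
      "summable (\<lambda>k. 2 powr n * V * (2 powr (- 2 * s)) ^ k)"
      by (auto intro!: summable_mult summable_geometric)
    then have "(\<Sum>k. ennreal (2 powr p * V * (2 powr (2 * s - 2)) ^ k)) \<noteq> top"
      "(\<Sum>k. ennreal (2 powr n * V * (2 powr (- 2 * s)) ^ k)) \<noteq> top"
      using V by (intro ennreal_suminf_neq_top; simp)+
    then show ?thesis
      unfolding int_\<alpha> int_\<beta> by (simp add: less_top[symmetric])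
  qed
  finally have "integrable lborel F"
    by (intro integrableI_nonneg) (auto simp: F_def[abs_def])
  then show ?thesis by (simp add: F_def[abs_def] p_def n_def)
qed

section \<open>Taylor bound, second derivative test and Laplacian\<close>

text \<open>Differentiability of \<open>G\<close> at the point \<open>x\<close> gives
  \<open>norm (G z - G x) \<le> (1 + B) * norm (z - x)\<close> nearby. The mean value inequality for
  \<open>f\<close> minus the linear map with gradient \<open>G x\<close>, on the ball of radius
  \<open>norm h\<close>, turns this into a quadratic remainder.\<close>

lemma taylor_bound:
  fixes f :: "'a::euclidean_space \<Rightarrow> real"
  assumes "open S" "x \<in> S"
    and f: "\<And>z. z \<in> S \<Longrightarrow> (f has_derivative (\<lambda>h. G z \<bullet> h)) (at z)"
    and G: "G differentiable (at x)"
  obtains C r where "0 < r" "0 \<le> C"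
    "\<And>h. norm h < r \<Longrightarrow> \<bar>f (x + h) - f x - G x \<bullet> h\<bar> \<le> C * (norm h)\<^sup>2"
proof -
  obtain D where D: "(G has_derivative D) (at x)" using G by (auto simp: differentiable_def)
  then obtain d where d: "d > 0"
    "\<And>z. norm (z - x) < d \<Longrightarrow> norm (G z - G x - D (z - x)) \<le> norm (z - x)"
    unfolding has_derivative_at_alt by (metis mult_1 zero_less_one)
  obtain B where B: "B > 0" "\<And>h. norm (D h) \<le> norm h * B"
    using bounded_linear.pos_bounded[OF has_derivative_bounded_linear[OF D]] by blast
  have lip: "norm (G z - G x) \<le> (1 + B) * norm (z - x)" if "norm (z - x) < d" for z
  proof -
    have "norm (G z - G x) \<le> norm (G z - G x - D (z - x)) + norm (D (z - x))"
      by (metis diff_add_cancel norm_triangle_ineq)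
    then show ?thesis using d(2)[OF that] B(2)[of "z - x"] by (simp add: algebra_simps)
  qed
  obtain q where q: "q > 0" "ball x q \<subseteq> S" using assms(1,2) open_contains_ball by blast
  show ?thesis
  proof (rule that[of "min d q" "1 + B"])
    fix h :: 'a assume h: "norm h < min d q"
    define w where "w z = f z - G x \<bullet> z" for z
    have "norm (w (x + h) - w x) \<le> ((1 + B) * norm h) * norm (x + h - x)"
    proof (rule differentiable_bound[of "cball x (norm h)" w "\<lambda>z k. (G z - G x) \<bullet> k"])
      fix z assume z: "z \<in> cball x (norm h)"
      then have nz: "norm (z - x) \<le> norm h" by (simp add: dist_norm norm_minus_commute)
      then have "z \<in> S" using h q by (auto simp: dist_norm norm_minus_commute subset_iff)
      then show "(w has_derivative (\<lambda>k. (G z - G x) \<bullet> k)) (at z within cball x (norm h))"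
        unfolding w_def inner_diff_left
        by (rule has_derivative_at_withinI[OF has_derivative_diff[OF f
              has_derivative_inner_right[OF has_derivative_ident]]])
      have "norm (G z - G x) \<le> (1 + B) * norm h"
        using lip[of z] nz h B by (smt (verit) mult_left_mono)
      then show "onorm (\<lambda>k. (G z - G x) \<bullet> k) \<le> (1 + B) * norm h"
        using Cauchy_Schwarz_ineq2[of "G z - G x"]
        by (intro onorm_le) (smt (verit) mult_right_mono norm_ge_zero real_norm_def)
    qed (auto simp: dist_norm)
    then show "\<bar>f (x + h) - f x - G x \<bullet> h\<bar> \<le> (1 + B) * (norm h)\<^sup>2"
      by (simp add: w_def inner_add_right power2_eq_square algebra_simps)
  qed (use d q B in auto)
qed

text \<open>If \<open>D < 0\<close>, then \<open>f'\<close>, which vanishes at the minimum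
  \<open>0\<close>, is negative just to the right of it, and the mean value theorem produces a
  smaller value of \<open>f\<close>.\<close>

lemma second_derivative_test:
  fixes f :: "real \<Rightarrow> real"
  assumes r: "0 < r"
    and f: "\<And>t. \<bar>t\<bar> < r \<Longrightarrow> (f has_real_derivative f' t) (at t)"
    and f': "(f' has_real_derivative D) (at 0)"
    and min: "\<And>t. \<bar>t\<bar> < r \<Longrightarrow> f 0 \<le> f t"
  shows "0 \<le> D"
proof (rule ccontr)
  assume "\<not> 0 \<le> D"
  then obtain d where d: "d > 0" "\<And>h. 0 < h \<Longrightarrow> h < d \<Longrightarrow> f' (0 + h) < f' 0"
    using DERIV_neg_dec_right[OF f'] by (meson not_le)
  have f0: "f' 0 = 0"
    using DERIV_local_min[OF f[of 0] r] min r by auto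
  define t where "t = min d r / 2"
  have t: "0 < t" "t < d" "t < r" using d r by (auto simp: t_def)
  obtain z where z: "0 < z" "z < t" "f t - f 0 = (t - 0) * f' z"
    using MVT2[of 0 t f f'] f t by (metis abs_of_nonneg order.strict_trans1)
  have "f' z < 0" using d(2)[of z] z t f0 by simp
  then have "f t < f 0" using z t by (smt (verit) mult_pos_neg)
  then show False using min[of t] t by simp
qed

lemma has_real_derivative_along_line:
  assumes "(u has_derivative (\<lambda>h. g \<bullet> h)) (at (x + t *\<^sub>R i))"
  shows "((\<lambda>t. u (x + t *\<^sub>R i)) has_real_derivative g \<bullet> i) (at t)"
proof -
  have "((\<lambda>t. u (x + t *\<^sub>R i)) has_derivative (\<lambda>t. g \<bullet> (t *\<^sub>R i))) (at t)"
    by (rule has_derivative_compose[of "\<lambda>t. x + t *\<^sub>R i" "\<lambda>t. t *\<^sub>R i" t UNIV u "\<lambda>h. g \<bullet> h"])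
       (use assms in \<open>auto intro!: derivative_eq_intros\<close>)
  then show ?thesis
    by (simp add: has_field_derivative_def mult_commute_abs)
qed

lemma partial_deriv_eq:
  assumes "(u has_derivative (\<lambda>h. g \<bullet> h)) (at x)"
  shows "partial_deriv u i x = g \<bullet> i"
  using has_real_derivative_along_line[of u g x 0 i] assms
  by (simp add: partial_deriv_def DERIV_imp_deriv)

text \<open>By \<open>sec\<close>, the function
  \<open>u (x + t i) + u (x - t i) + 2 \<delta> t\<^sup>2\<close> of \<open>t\<close> is minimal at
  \<open>t = 0\<close>. Its second derivative there is twice the pure second derivative of
  \<open>u\<close> in direction \<open>i\<close> plus \<open>4 \<delta>\<close>. Symmetrizing
  removes the gradient of \<open>u\<close> at \<open>x\<close>, which need not vanish.\<close>

lemma laplacian_lower_bound: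
  fixes u :: "'a::euclidean_space \<Rightarrow> real"
  assumes "open \<Omega>" "x \<in> \<Omega>"
    and G: "\<And>z. z \<in> \<Omega> \<Longrightarrow> (u has_derivative (\<lambda>h. G z \<bullet> h)) (at z)"
    and H: "\<And>i. i \<in> Basis \<Longrightarrow> ((\<lambda>z. G z \<bullet> i) has_derivative (\<lambda>h. H i \<bullet> h)) (at x)"
    and sec: "\<And>y. 2 * u x - u (x + y) - u (x - y) \<le> 2 * \<delta> * (norm y)\<^sup>2"
  shows "laplacian u x \<ge> - (2 * \<delta> * DIM('a))"
proof -
  obtain r where r: "r > 0" "ball x r \<subseteq> \<Omega>" using assms(1,2) open_contains_ball by blast
  have "partial_deriv (partial_deriv u i) i x \<ge> - (2 * \<delta>)" if i: "i \<in> Basis" for i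
  proof -
    have mem: "x + t *\<^sub>R i \<in> \<Omega>" if "\<bar>t\<bar> < r" for t
      using r that i by (auto simp: subset_iff dist_norm)
    have pd: "partial_deriv u i z = G z \<bullet> i" if "z \<in> \<Omega>" for z
      by (rule partial_deriv_eq[OF G[OF that]])
    \<comment> \<open>\<open>partial_deriv u i\<close> is a total function that is known to equal
      \<open>G z \<bullet> i\<close> only for \<open>z\<close> in the open set
      \<open>\<Omega>\<close>; this suffices for the derivative at \<open>x\<close>.\<close>
    have "((partial_deriv u i) has_derivative (\<lambda>h. H i \<bullet> h)) (at x)"
      using has_derivative_transform_within_open[OF H[OF i] assms(1,2)] pd by metis
    then have eq: "partial_deriv (partial_deriv u i) i x = H i \<bullet> i" by (rule partial_deriv_eq)
    have Hp: "((\<lambda>t. G (x + t *\<^sub>R i) \<bullet> i) has_real_derivative H i \<bullet> i) (at 0)"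
      using has_real_derivative_along_line[of "\<lambda>z. G z \<bullet> i" "H i" x 0 i] H[OF i] by simp
    have Hm: "((\<lambda>t. G (x + t *\<^sub>R (- i)) \<bullet> i) has_real_derivative H i \<bullet> (- i)) (at 0)"
      using has_real_derivative_along_line[of "\<lambda>z. G z \<bullet> i" "H i" x 0 "- i"] H[OF i] by simp
    have "0 \<le> H i \<bullet> i - H i \<bullet> (- i) + 4 * \<delta>"
    proof (rule second_derivative_test[OF r(1)])
      show "((\<lambda>t. u (x + t *\<^sub>R i) + u (x + t *\<^sub>R (- i)) + 2 * \<delta> * t\<^sup>2) has_real_derivative
          (G (x + t *\<^sub>R i) \<bullet> i - G (x + t *\<^sub>R (- i)) \<bullet> i + 4 * \<delta> * t)) (at t)" if t: "\<bar>t\<bar> < r" for t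
      proof -
        have 1: "((\<lambda>t. u (x + t *\<^sub>R i)) has_real_derivative G (x + t *\<^sub>R i) \<bullet> i) (at t)"
          by (intro has_real_derivative_along_line G mem t)
        have 2: "((\<lambda>t. u (x + t *\<^sub>R (- i))) has_real_derivative G (x + t *\<^sub>R (- i)) \<bullet> (- i)) (at t)"
          using mem[of "- t"] t by (intro has_real_derivative_along_line G) auto
        have 3: "((\<lambda>t. 2 * \<delta> * t\<^sup>2) has_real_derivative 4 * \<delta> * t) (at t)"
          by (auto intro!: derivative_eq_intros)
        show ?thesis using DERIV_add[OF DERIV_add[OF 1 2] 3] by simp
      qed
      have 3: "((\<lambda>t. 4 * \<delta> * t) has_real_derivative 4 * \<delta>) (at 0)"
        by (auto intro!: derivative_eq_intros)
      show "((\<lambda>t. G (x + t *\<^sub>R i) \<bullet> i - G (x + t *\<^sub>R (- i)) \<bullet> i + 4 * \<delta> * t) has_real_derivative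
          H i \<bullet> i - H i \<bullet> (- i) + 4 * \<delta>) (at 0)"
        by (rule DERIV_add[OF DERIV_diff[OF Hp Hm] 3])
      show "u (x + 0 *\<^sub>R i) + u (x + 0 *\<^sub>R (- i)) + 2 * \<delta> * 0\<^sup>2
          \<le> u (x + t *\<^sub>R i) + u (x + t *\<^sub>R (- i)) + 2 * \<delta> * t\<^sup>2" for t
        using sec[of "t *\<^sub>R i"] i by (simp add: power_mult_distrib)
    qed
    then show ?thesis by (simp add: eq)
  qed
  then have "(\<Sum>i\<in>(Basis::'a set). - (2 * \<delta>)) \<le> laplacian u x"
    unfolding laplacian_def by (intro sum_mono)
  then show ?thesis by (simp add: mult.commute)
qed

section \<open>Integrability and upper bound for the fractional Laplacian\<close>

text \<open>Without integrability the Bochner integral in the definition of the fractional Laplacian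
  would be the junk value \<open>0\<close>.\<close>
lemma frac_laplacian_integrable:
  fixes u :: "'a::euclidean_space \<Rightarrow> real"
  assumes s: "0 < s" "s < 1" and "continuous_on UNIV u" "bounded (range u)"
    and r: "0 < r" and taylor: "\<And>h. norm h < r \<Longrightarrow> \<bar>u (x + h) - u x - g \<bullet> h\<bar> \<le> C * (norm h)\<^sup>2"
  shows "integrable lborel (\<lambda>y. (2 * u x - u (x + y) - u (x - y)) /
                                norm y powr (real DIM('a) + 2 * s))"
proof -
  obtain M where M: "\<And>z. \<bar>u z\<bar> \<le> M"
    using assms(4) by (auto simp: bounded_iff)
  have M0: "M \<ge> 0" using M[of x] by linarith
  \<comment> \<open>For \<open>norm y < min r 1\<close> the Taylor bounds at \<open>y\<close> and
    \<open>-y\<close> add up to \<open>2 * C * (norm y)\<^sup>2\<close>, the linear terms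
    cancelling. Elsewhere the trivial bound \<open>4 * M\<close> is at most
    \<open>A * min r 1 ^ 2\<close>. Both are at most
    \<open>A * min ((norm y)\<^sup>2) 1\<close>.\<close>
  define A where "A = max (2 * C) (4 * M / min r 1 ^ 2)"
  have A: "A \<ge> 2 * C" "A \<ge> 4 * M / min r 1 ^ 2" by (auto simp: A_def)
  have A0: "A \<ge> 0" using A(2) M0 by (smt (verit) divide_nonneg_nonneg zero_le_power2 mult_nonneg_nonneg)
  have AM: "4 * M \<le> A * min r 1 ^ 2" using A(2) r by (simp add: divide_le_eq)
  have bd: "\<bar>2 * u x - u (x + y) - u (x - y)\<bar> \<le> A * min ((norm y)\<^sup>2) 1" for y
  proof (cases "norm y < min r 1")
    case True
    then have y: "norm y < r" "norm y < 1" by auto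
    have "(norm y)\<^sup>2 \<le> 1" using y by (simp add: power_le_one)
    moreover have "\<bar>2 * u x - u (x + y) - u (x - y)\<bar> \<le> 2 * C * (norm y)\<^sup>2"
      using taylor[OF y(1)] taylor[of "- y"] y(1) by simp
    moreover have "2 * C * (norm y)\<^sup>2 \<le> A * (norm y)\<^sup>2"
      using A(1) by (intro mult_right_mono) auto
    ultimately show ?thesis by (simp add: min_def)
  next
    case False
    then have "min r 1 ^ 2 \<le> (norm y)\<^sup>2" "min r 1 ^ 2 \<le> 1"
      using r by (auto intro!: power_mono power_le_one)
    then have "A * min r 1 ^ 2 \<le> A * min ((norm y)\<^sup>2) 1"
      using A0 by (intro mult_left_mono) auto
    moreover have "\<bar>2 * u x - u (x + y) - u (x - y)\<bar> \<le> 4 * M"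
      using M[of x] M[of "x + y"] M[of "x - y"] by linarith
    ultimately show ?thesis using AM by linarith
  qed
  have [measurable]: "u \<in> borel_measurable borel"
    using assms(3) by (rule borel_measurable_continuous_onI)
  show ?thesis
  proof (rule Bochner_Integration.integrable_bound[OF
        integrable_mult_right[OF fractional_kernel_integrable[OF s], of A]])
    show "AE y in lborel. norm ((2 * u x - u (x + y) - u (x - y)) / norm y powr (real DIM('a) + 2 * s))
        \<le> norm (A * (min ((norm y)\<^sup>2) 1 / norm y powr (real DIM('a) + 2 * s)))"
    proof (intro AE_I2)
      fix y :: 'a
      have "\<bar>2 * u x - u (x + y) - u (x - y)\<bar> / norm y powr (real DIM('a) + 2 * s)
        \<le> A * min ((norm y)\<^sup>2) 1 / norm y powr (real DIM('a) + 2 * s)"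
        by (intro divide_right_mono bd) auto
      then show "norm ((2 * u x - u (x + y) - u (x - y)) / norm y powr (real DIM('a) + 2 * s))
        \<le> norm (A * (min ((norm y)\<^sup>2) 1 / norm y powr (real DIM('a) + 2 * s)))"
        using A0 by (simp add: abs_mult)
    qed
  qed measurable
qed

text \<open>The \<open>itself\<close> argument selects the space of integration, which neither
  \<open>s\<close> nor the real result determines.\<close>

definition kernel_mass :: "real \<Rightarrow> 'a::euclidean_space itself \<Rightarrow> real" where
  "kernel_mass s _ = (\<integral>y. min ((norm (y::'a))\<^sup>2) 1 / norm y powr (real DIM('a) + 2 * s) \<partial>lborel)"

text \<open>Near \<open>0\<close> the assumption \<open>sec\<close>, and away from it
  \<open>ge\<close> with \<open>le\<close>, bound the second difference by
  \<open>2 * \<delta> * min ((norm y)\<^sup>2) 1\<close>. If \<open>x + y\<close> lies in the bump,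
  it is at most \<open>2 * \<delta> - m\<close>, and \<open>4 * \<delta> \<le> m\<close> leaves room
  to subtract \<open>m / 4\<close> from the first bound. There the kernel is at least
  \<open>1 / T powr p\<close>. The prefactor \<open>1/2\<close> turns \<open>2 * \<delta>\<close>
  into \<open>\<delta>\<close> and \<open>m / 4\<close> into \<open>m / 8\<close>.\<close>

lemma frac_laplacian_upper_bound:
  fixes u :: "'a::euclidean_space \<Rightarrow> real"
  assumes s: "0 < s" "s < 1"
    and int: "integrable lborel (\<lambda>y. (2 * u x - u (x + y) - u (x - y)) /
                                norm y powr (real DIM('a) + 2 * s))"
    and ge: "\<And>y. c \<le> u y" and le: "u x \<le> c + \<delta>"
    and sec: "\<And>y. 2 * u x - u (x + y) - u (x - y) \<le> 2 * \<delta> * (norm y)\<^sup>2"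
    and bump: "\<And>y. y \<in> ball z \<rho> \<Longrightarrow> c + m \<le> u y"
    and \<delta>: "4 * \<delta> \<le> m" and m: "0 < m" and \<rho>: "0 < \<rho>" and T: "norm (z - x) + \<rho> \<le> T"
  shows "frac_laplacian s u x \<le> \<delta> * kernel_mass s TYPE('a)
           - m / 8 * (measure lborel (ball (0::'a) \<rho>) / T powr (real DIM('a) + 2 * s))"
proof -
  define p where "p = real DIM('a) + 2 * s"
  have p: "p > 0" using s by (simp add: p_def)
  have d0: "\<delta> \<ge> 0" using ge[of x] le by linarith
  define f where "f y = (2 * u x - u (x + y) - u (x - y)) / norm y powr p" for y
  define k :: "'a \<Rightarrow> real" where "k y = min ((norm y)\<^sup>2) 1 / norm y powr p" for y
  define b :: "'a \<Rightarrow> real" where "b y = indicator (ball (z - x) \<rho>) y" for y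
  have ik: "integrable lborel k"
    using fractional_kernel_integrable[OF s] by (simp add: k_def[abs_def] p_def)
  have ib: "integrable lborel b"
    unfolding b_def by (intro integrable_real_indicator) (use \<rho> in \<open>auto simp: emeasure_ball\<close>)
  have T0: "T > 0" using T \<rho> norm_ge_zero[of "z - x"] by linarith
  have ptw: "f y \<le> 2 * \<delta> * k y - m / (4 * T powr p) * b y" for y
  proof -
    have N: "2 * u x - u (x + y) - u (x - y) \<le> 2 * \<delta> * min ((norm y)\<^sup>2) 1"
      using sec[of y] ge[of "x + y"] ge[of "x - y"] le d0 by (auto simp: min_def)
    show ?thesis
    proof (cases "y \<in> ball (z - x) \<rho>")
      case False
      have "f y \<le> 2 * \<delta> * min ((norm y)\<^sup>2) 1 / norm y powr p"
        unfolding f_def by (intro divide_right_mono N) auto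
      then show ?thesis using False by (simp add: b_def k_def)
    next
      case True
      have "dist z (x + y) = dist (z - x) y" by (simp add: dist_norm diff_diff_eq)
      then have xy: "x + y \<in> ball z \<rho>" using True by simp
      \<comment> \<open>At \<open>y = 0\<close> the quotient is \<open>0\<close> by the convention
        on division, which would violate the negative bound. The bump does not contain
        \<open>x\<close>, since \<open>u x \<le> c + \<delta> < c + m\<close>.\<close>
      have "y \<noteq> 0"
      proof
        assume "y = 0"
        then have "c + m \<le> u x" using bump[OF xy] by simp
        then show False using le \<delta> m d0 by linarith
      qed
      then have y0: "norm y > 0" by simp
      have "norm y - norm (z - x) \<le> norm (y - (z - x))" by (rule norm_triangle_ineq2)
      also have "\<dots> < \<rho>" using True by (simp add: dist_norm norm_minus_commute)
      finally have "norm y \<le> T" using T by linarith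
      then have yT: "norm y powr p \<le> T powr p" using p by (intro powr_mono2) auto
      have a0: "0 \<le> 2 * \<delta> * min ((norm y)\<^sup>2) 1" using d0 by simp
      have "2 * u x - u (x + y) - u (x - y) \<le> 2 * \<delta> - m"
        using le bump[OF xy] ge[of "x - y"] by linarith
      then have "2 * u x - u (x + y) - u (x - y) \<le> 2 * \<delta> * min ((norm y)\<^sup>2) 1 - m / 4"
        using N \<delta> a0 by linarith
      then have "f y \<le> (2 * \<delta> * min ((norm y)\<^sup>2) 1 - m / 4) / norm y powr p"
        unfolding f_def by (intro divide_right_mono) auto
      also have "\<dots> = 2 * \<delta> * k y - m / 4 / norm y powr p"
        by (simp add: k_def diff_divide_distrib)
      also have "\<dots> \<le> 2 * \<delta> * k y - m / 4 / T powr p"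
        using yT y0 m T0 by (intro diff_left_mono divide_left_mono) auto
      finally show ?thesis using True by (simp add: b_def)
    qed
  qed
  have "integral\<^sup>L lborel f \<le> (\<integral>y. 2 * \<delta> * k y - m / (4 * T powr p) * b y \<partial>lborel)"
    using int ik ib ptw
    by (intro integral_mono) (auto simp: f_def[abs_def] p_def)
  also have "\<dots> = 2 * \<delta> * integral\<^sup>L lborel k - m / (4 * T powr p) * integral\<^sup>L lborel b"
    using ik ib by simp
  also have "integral\<^sup>L lborel b = measure lborel (ball (0::'a) \<rho>)"
    using \<rho> by (simp add: b_def[abs_def] content_ball)
  finally show ?thesis
    by (simp add: frac_laplacian_def kernel_mass_def f_def k_def p_def field_simps)
qed

section \<open>Negativity of the operator, strong maximum principle and barrier\<close>

text \<open>The term \<open>2 * DIM('a)\<close> in \<open>small\<close> pays for the Laplacian,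
  \<open>kernel_mass\<close> for the singular part. \<open>T\<close> is any upper bound for
  \<open>norm (z - x) + \<rho>\<close>, so that \<open>\<delta>\<close> can be fixed before the
  point \<open>x\<close> is known.\<close>

lemma mixed_op_neg:
  fixes u :: "'a::euclidean_space \<Rightarrow> real"
  assumes s: "0 < s" "s < 1"
    and "open \<Omega>" "x \<in> \<Omega>" "continuous_on UNIV u" "bounded (range u)" "C2_closure u \<Omega>"
    and ge: "\<And>y. c \<le> u y" and le: "u x \<le> c + \<delta>"
    and sec: "\<And>y. 2 * u x - u (x + y) - u (x - y) \<le> 2 * \<delta> * (norm y)\<^sup>2"
    and bump: "\<And>y. y \<in> ball z \<rho> \<Longrightarrow> c + m \<le> u y"
    and \<delta>: "4 * \<delta> \<le> m" and m: "0 < m" and \<rho>: "0 < \<rho>" and T: "norm (z - x) + \<rho> \<le> T"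
    and small: "\<delta> * (kernel_mass s TYPE('a) + 2 * DIM('a))
      < m / 8 * (measure lborel (ball (0::'a) \<rho>) / T powr (real DIM('a) + 2 * s))"
  shows "mixed_op s u x < 0"
proof -
  obtain G H where G: "\<And>z. z \<in> \<Omega> \<Longrightarrow> (u has_derivative (\<lambda>h. G z \<bullet> h)) (at z)"
    and H: "\<And>z i. z \<in> \<Omega> \<Longrightarrow> i \<in> Basis \<Longrightarrow> ((\<lambda>y. G y \<bullet> i) has_derivative (\<lambda>h. H z i \<bullet> h)) (at z)"
    using assms(7) unfolding C2_closure_def by blast
  have "G differentiable (at x)"
    using H[OF assms(4)] by (subst differentiable_componentwise_within) (auto simp: differentiable_def)
  then obtain C r where r: "0 < r"
    "\<And>h. norm h < r \<Longrightarrow> \<bar>u (x + h) - u x - G x \<bullet> h\<bar> \<le> C * (norm h)\<^sup>2"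
    using taylor_bound[OF assms(3,4) G] by blast
  have "frac_laplacian s u x \<le> \<delta> * kernel_mass s TYPE('a)
           - m / 8 * (measure lborel (ball (0::'a) \<rho>) / T powr (real DIM('a) + 2 * s))"
    by (rule frac_laplacian_upper_bound[OF s frac_laplacian_integrable[OF s assms(5,6) r]
          ge le sec bump \<delta> m \<rho> T])
  moreover have "laplacian u x \<ge> - (2 * \<delta> * DIM('a))"
    by (rule laplacian_lower_bound[OF assms(3,4) G H[OF assms(4)] sec])
  ultimately show ?thesis using small by (simp add: mixed_op_def algebra_simps)
qed

text \<open>A point with \<open>u x = c\<close> is a global minimum, so its second differences are
  nonpositive and \<open>mixed_op_neg\<close> applies with \<open>\<delta> = 0\<close>. The bump is
  a neighbourhood of \<open>z\<close>, which may lie anywhere in the space.\<close>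

lemma strong_maximum_principle:
  fixes u :: "'a::euclidean_space \<Rightarrow> real"
  assumes s: "0 < s" "s < 1"
    and "open \<Omega>" "continuous_on UNIV u" "bounded (range u)" "C2_closure u \<Omega>"
    and sup: "\<And>x. x \<in> \<Omega> \<Longrightarrow> 0 \<le> mixed_op s u x"
    and ge: "\<And>x. c \<le> u x" and "u z \<noteq> c" and x: "x \<in> \<Omega>"
  shows "c < u x"
proof (rule ccontr)
  assume "\<not> c < u x"
  then have ux: "u x = c" using ge[of x] by simp
  define m where "m = (u z - c) / 2"
  have m: "m > 0" using ge[of z] assms(9) by (simp add: m_def)
  have "isCont u z" using assms(4) by (simp add: continuous_on_eq_continuous_at)
  then obtain \<rho> where \<rho>: "\<rho> > 0" "\<And>y. dist y z < \<rho> \<Longrightarrow> dist (u y) (u z) < m"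
    using m unfolding continuous_at_eps_delta by blast
  have bump: "c + m \<le> u y" if "y \<in> ball z \<rho>" for y
    using \<rho>(2)[of y] that by (simp add: dist_commute dist_real_def m_def abs_if field_simps split: if_splits)
  have "norm (z - x) + \<rho> > 0" using \<rho>(1) by (simp add: add_nonneg_pos)
  then have pos: "0 < m / 8 * (measure lborel (ball (0::'a) \<rho>) / (norm (z - x) + \<rho>) powr (real DIM('a) + 2 * s))"
    using m \<rho>(1) by (intro mult_pos_pos divide_pos_pos) (auto simp: content_ball_pos)
  have "mixed_op s u x < 0"
  proof (rule mixed_op_neg[OF s assms(3) x assms(4-6) ge _ _ bump _ m \<rho>(1) order_refl, where \<delta> = 0])
    show "2 * u x - u (x + y) - u (x - y) \<le> 2 * 0 * (norm y)\<^sup>2" for y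
      using ge[of "x + y"] ge[of "x - y"] ux by simp
  qed (use ux m pos in auto)
  then show False using sup[OF x] by simp
qed

lemma barrier_comparison:
  fixes u :: "'a::euclidean_space \<Rightarrow> real"
  assumes s: "0 < s" "s < 1"
    and "open \<Omega>" "continuous_on UNIV u" "bounded (range u)" "C2_closure u \<Omega>"
    and sup: "\<And>x. x \<in> \<Omega> \<Longrightarrow> 0 \<le> mixed_op s u x"
    and ge: "\<And>x. c \<le> u x" and "u z \<noteq> c"
    and R: "0 < R" "R \<le> 1" and sub: "ball x0 R \<subseteq> \<Omega>"
  obtains \<delta> where "0 < \<delta>" "\<And>x. c + \<delta> * (R\<^sup>2 - (norm (x - x0))\<^sup>2) \<le> u x"
proof -
  define K where "K = cball x0 (R / 2)"
  have "K \<subseteq> ball x0 R" using R by (auto simp: K_def)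
  then have pos: "c < u x" if "x \<in> K" for x
    using strong_maximum_principle[OF s assms(3-6) sup ge assms(9)] sub that by blast
  have "compact K" "K \<noteq> {}" "continuous_on K u"
    using R assms(4) by (auto simp: K_def intro: continuous_on_subset)
  from continuous_attains_inf[OF this] obtain k where k: "k \<in> K" "\<And>y. y \<in> K \<Longrightarrow> u k \<le> u y"
    by blast
  define m where "m = u k - c"
  have m: "m > 0" using pos[OF k(1)] by (simp add: m_def)
  define \<rho> where "\<rho> = R / 2"
  have \<rho>: "\<rho> > 0" using R by (simp add: \<rho>_def)
  have bump: "c + m \<le> u y" if "y \<in> ball x0 \<rho>" for y
    using k(2)[of y] that by (simp add: m_def K_def \<rho>_def)
  \<comment> \<open>\<open>T = 2\<close> serves every \<open>x\<close> in \<open>ball x0 R\<close>,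
    because \<open>R + R / 2 < 2\<close>; hence \<open>q\<close> does not depend on where the
    minimum of \<open>v\<close> will be.\<close>
  define q where "q = m / 8 * (measure lborel (ball (0::'a) \<rho>) / 2 powr (real DIM('a) + 2 * s))"
  have q: "q > 0" unfolding q_def
    using m \<rho> by (intro mult_pos_pos divide_pos_pos) (auto simp: content_ball_pos)
  define J where "J = kernel_mass s TYPE('a) + 2 * DIM('a)"
  have J: "J > 0"
    unfolding J_def kernel_mass_def by (intro add_nonneg_pos integral_nonneg_AE) auto
  \<comment> \<open>The first entry gives \<open>4 * \<delta> \<le> m\<close>, the second
    \<open>\<delta> * J \<le> q / 2\<close>.\<close>
  define \<delta> where "\<delta> = min (m / 4) (q / (2 * J))"
  have \<delta>: "0 < \<delta>" "4 * \<delta> \<le> m" using m q J by (auto simp: \<delta>_def)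
  have "\<delta> * J \<le> q / (2 * J) * J" using J by (intro mult_right_mono) (auto simp: \<delta>_def)
  then have small: "\<delta> * J < q" using J q by simp
  define v where "v x = u x - c - \<delta> * (R\<^sup>2 - (norm (x - x0))\<^sup>2)" for x
  have "continuous_on (cball x0 R) v"
    unfolding v_def by (intro continuous_intros continuous_on_subset[OF assms(4)]) auto
  then obtain x where x: "x \<in> cball x0 R" "\<And>y. y \<in> cball x0 R \<Longrightarrow> v x \<le> v y"
    using continuous_attains_inf[of "cball x0 R" v] R by auto
  have out: "0 \<le> v y" if "y \<notin> ball x0 R" for y
  proof -
    have "R \<le> norm (y - x0)" using that by (simp add: dist_norm norm_minus_commute)
    then have "R\<^sup>2 \<le> (norm (y - x0))\<^sup>2" using R by (intro power_mono) auto
    then have "\<delta> * (R\<^sup>2 - (norm (y - x0))\<^sup>2) \<le> 0" using \<delta>(1) by (simp add: mult_le_0_iff)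
    then show ?thesis using ge[of y] by (simp add: v_def)
  qed
  have "0 \<le> v x"
  proof (rule ccontr)
    assume neg: "\<not> 0 \<le> v x"
    then have xb: "x \<in> ball x0 R" using out by blast
    \<comment> \<open>Outside the ball the paraboloid is nonpositive, so \<open>v\<close> is
      nonnegative there and a negative minimum over the closed ball is a global one.\<close>
    have min: "v x \<le> v y" for y
      using x(2)[of y] out[of y] neg by (cases "y \<in> ball x0 R") auto
    have "\<delta> * (R\<^sup>2 - (norm (x - x0))\<^sup>2) \<le> \<delta> * 1"
      using \<delta>(1) power_le_one[of R 2] R
      by (intro mult_left_mono) (auto intro: order_trans[OF _ power_le_one[of R 2]])
    then have le: "u x \<le> c + \<delta>" using neg by (simp add: v_def)
    \<comment> \<open>By the parallelogram law the paraboloid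
      \<open>\<delta> * (R\<^sup>2 - (norm (x - x0))\<^sup>2)\<close> has second difference exactly
      \<open>2 * \<delta> * (norm y)\<^sup>2\<close>, while that of \<open>v\<close> is nonpositive
      at its minimum.\<close>
    have sec: "2 * u x - u (x + y) - u (x - y) \<le> 2 * \<delta> * (norm y)\<^sup>2" for y
    proof -
      have "(norm (x + y - x0))\<^sup>2 + (norm (x - y - x0))\<^sup>2 = 2 * (norm (x - x0))\<^sup>2 + 2 * (norm y)\<^sup>2"
        unfolding power2_norm_eq_inner by (simp add: inner_simps inner_commute algebra_simps)
      then have "\<delta> * (norm (x + y - x0))\<^sup>2 + \<delta> * (norm (x - y - x0))\<^sup>2
          = 2 * \<delta> * (norm (x - x0))\<^sup>2 + 2 * \<delta> * (norm y)\<^sup>2"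
        by (metis (no_types, opaque_lifting) distrib_left mult.assoc mult.commute)
      then show ?thesis
        using min[of "x + y"] min[of "x - y"] by (simp add: v_def right_diff_distrib)
    qed
    have T: "norm (x0 - x) + \<rho> \<le> 2" using xb R by (simp add: dist_norm \<rho>_def)
    have "mixed_op s u x < 0"
      using mixed_op_neg[OF s assms(3) _ assms(4-6) ge le sec bump \<delta>(2) m \<rho> T] small sub xb
      by (auto simp: J_def q_def)
    then show False using sup[of x] sub xb by (meson not_le subsetD)
  qed
  then have "0 \<le> v y" for y using x(2)[of y] out[of y] by (cases "y \<in> ball x0 R") auto
  then have "c + \<delta> * (R\<^sup>2 - (norm (y - x0))\<^sup>2) \<le> u y" for y
    unfolding v_def by (simp add: le_diff_eq add.commute)
  then show ?thesis using that[OF \<delta>(1)] by blast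
qed

section \<open>Defining functions, outer normal and interior ball\<close>

lemma bdry_graphD:
  assumes "bdry_graph g \<Omega> p e r"
  shows "norm e = 1" "0 < r"
    "x \<in> ball p r \<Longrightarrow> x \<in> \<Omega> \<longleftrightarrow> x \<bullet> e - g (x - (x \<bullet> e) *\<^sub>R e) < 0"
proof -
  have eq: "\<Omega> \<inter> ball p r = {x \<in> ball p r. x \<bullet> e < g (x - (x \<bullet> e) *\<^sub>R e)}"
    using assms unfolding bdry_graph_def by blast
  show "x \<in> \<Omega> \<longleftrightarrow> x \<bullet> e - g (x - (x \<bullet> e) *\<^sub>R e) < 0" if "x \<in> ball p r"
  proof -
    have "x \<in> \<Omega> \<longleftrightarrow> x \<in> \<Omega> \<inter> ball p r" using that by blast
    then show ?thesis unfolding eq using that by simp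
  qed
qed (use assms in \<open>auto simp only: bdry_graph_def\<close>)

text \<open>\<open>bdry_graph\<close> describes \<open>\<Omega>\<close> but not its frontier. The
  value is nonnegative because \<open>\<xi>\<close> is outside the open set \<open>\<Omega>\<close>;
  a positive value would persist nearby and keep \<open>\<Omega>\<close> away from
  \<open>\<xi>\<close>.\<close>

lemma defining_function_frontier_zero:
  assumes "open \<Omega>" "\<xi> \<in> frontier \<Omega>" "bdry_graph g \<Omega> \<xi> e r"
    and "isCont (\<lambda>x. x \<bullet> e - g (x - (x \<bullet> e) *\<^sub>R e)) \<xi>"
  shows "\<xi> \<bullet> e - g (\<xi> - (\<xi> \<bullet> e) *\<^sub>R e) = 0"
proof -
  define \<phi> where "\<phi> x = x \<bullet> e - g (x - (x \<bullet> e) *\<^sub>R e)" for x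
  have r: "r > 0" and \<Omega>: "\<And>x. x \<in> ball \<xi> r \<Longrightarrow> x \<in> \<Omega> \<longleftrightarrow> \<phi> x < 0"
    using bdry_graphD[OF assms(3)] unfolding \<phi>_def by blast+
  have "\<xi> \<notin> \<Omega>" and cl: "\<xi> \<in> closure \<Omega>"
    using assms(1,2) by (auto simp: frontier_def interior_open)
  then have "\<phi> \<xi> \<ge> 0" using \<Omega>[of \<xi>] r by simp
  moreover have "\<phi> \<xi> \<le> 0"
  proof (rule ccontr)
    assume "\<not> \<phi> \<xi> \<le> 0"
    moreover have "isCont \<phi> \<xi>" using assms(4) by (simp add: \<phi>_def[abs_def])
    ultimately obtain d where d: "d > 0" "\<And>y. dist y \<xi> < d \<Longrightarrow> dist (\<phi> y) (\<phi> \<xi>) < \<phi> \<xi>"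
      unfolding continuous_at_eps_delta by (meson not_le)
    obtain y where y: "y \<in> \<Omega>" "dist y \<xi> < min d r"
      using cl d(1) r unfolding closure_approachable by (metis min_less_iff_conj)
    then have "\<phi> y < 0" using \<Omega>[of y] by (simp add: dist_commute)
    then show False using d(2)[of y] y by (simp add: dist_real_def)
  qed
  ultimately show ?thesis by (simp add: \<phi>_def)
qed

text \<open>Moving along \<open>e\<close> leaves the projection unchanged, so the defining function
  grows at unit rate. In particular its gradient does not vanish.\<close>

lemma defining_gradient_inner:
  assumes "norm e = 1"
    and "((\<lambda>x. x \<bullet> e - g (x - (x \<bullet> e) *\<^sub>R e)) has_derivative (\<lambda>h. N \<bullet> h)) (at \<xi>)"
  shows "N \<bullet> e = 1"
proof -
  define \<phi> where "\<phi> x = x \<bullet> e - g (x - (x \<bullet> e) *\<^sub>R e)" for x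
  have ee: "e \<bullet> e = 1" using assms(1) by (simp add: norm_eq_1)
  have "(\<phi> has_derivative (\<lambda>h. N \<bullet> h)) (at (\<xi> + 0 *\<^sub>R e))"
    using assms(2) by (simp add: \<phi>_def[abs_def])
  from has_real_derivative_along_line[OF this]
  have 1: "((\<lambda>t. \<phi> (\<xi> + t *\<^sub>R e)) has_real_derivative N \<bullet> e) (at 0)" .
  have "(\<lambda>t. \<phi> (\<xi> + t *\<^sub>R e)) = (\<lambda>t. \<phi> \<xi> + t)"
    by (simp add: \<phi>_def inner_add_left ee scaleR_add_left fun_eq_iff)
  moreover have "((\<lambda>t. \<phi> \<xi> + t) has_real_derivative 1) (at 0)"
    by (auto intro!: derivative_eq_intros)
  ultimately show ?thesis using DERIV_unique[OF 1] by simp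
qed

text \<open>If \<open>a \<noteq> b\<close>, then \<open>h = b - a\<close> has
  \<open>a \<bullet> h < 0 < b \<bullet> h\<close>.\<close>

lemma unit_vectors_eq_if_halfspace:
  fixes a b :: "'a::real_inner"
  assumes "norm a = 1" "norm b = 1" and half: "\<And>h. a \<bullet> h < 0 \<Longrightarrow> b \<bullet> h \<le> 0"
  shows "a = b"
proof (rule ccontr)
  assume "a \<noteq> b"
  have ab: "a \<bullet> a = 1" "b \<bullet> b = 1" using assms(1,2) by (simp_all add: norm_eq_1)
  have "0 < (a - b) \<bullet> (a - b)" using \<open>a \<noteq> b\<close> by simp
  then have "a \<bullet> b < 1" using ab by (simp add: inner_simps inner_commute)
  then show False using half[of "b - a"] ab by (simp add: inner_simps inner_commute)
qed

text \<open>The normal may come from a different graph representation than \<open>g\<close>. Both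
  defining functions are negative exactly on \<open>\<Omega>\<close> near \<open>\<xi>\<close>; a
  direction \<open>h\<close> with \<open>N' \<bullet> h < 0 < N \<bullet> h\<close> would put points
  \<open>\<xi> + t h\<close> both inside and outside \<open>\<Omega>\<close>.\<close>

lemma outer_normal_eq_normalized_gradient:
  fixes \<Omega> :: "'a::euclidean_space set"
  assumes "open \<Omega>" "\<xi> \<in> frontier \<Omega>" and nu: "outer_unit_normal \<Omega> \<xi> \<nu>"
    and gr: "bdry_graph g \<Omega> \<xi> e r"
    and der: "((\<lambda>x. x \<bullet> e - g (x - (x \<bullet> e) *\<^sub>R e)) has_derivative (\<lambda>h. N \<bullet> h)) (at \<xi>)"
  shows "N = norm N *\<^sub>R \<nu>" "norm N > 0" "norm \<nu> = 1"
proof -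
  obtain g' e' r' N' where gr': "bdry_graph g' \<Omega> \<xi> e' r'"
    and der': "((\<lambda>x. x \<bullet> e' - g' (x - (x \<bullet> e') *\<^sub>R e')) has_derivative (\<lambda>h. N' \<bullet> h)) (at \<xi>)"
    and \<nu>: "\<nu> = N' /\<^sub>R norm N'"
    using nu unfolding outer_unit_normal_def by blast
  define \<phi> where "\<phi> x = x \<bullet> e - g (x - (x \<bullet> e) *\<^sub>R e)" for x
  define \<psi> where "\<psi> x = x \<bullet> e' - g' (x - (x \<bullet> e') *\<^sub>R e')" for x
  have d\<phi>: "(\<phi> has_derivative (\<lambda>h. N \<bullet> h)) (at \<xi>)" using der by (simp add: \<phi>_def[abs_def])
  have d\<psi>: "(\<psi> has_derivative (\<lambda>h. N' \<bullet> h)) (at \<xi>)" using der' by (simp add: \<psi>_def[abs_def])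
  have r: "r > 0" "norm e = 1" and \<Omega>: "\<And>x. x \<in> ball \<xi> r \<Longrightarrow> x \<in> \<Omega> \<longleftrightarrow> \<phi> x < 0"
    using bdry_graphD[OF gr] unfolding \<phi>_def by blast+
  have r': "r' > 0" "norm e' = 1" and \<Omega>': "\<And>x. x \<in> ball \<xi> r' \<Longrightarrow> x \<in> \<Omega> \<longleftrightarrow> \<psi> x < 0"
    using bdry_graphD[OF gr'] unfolding \<psi>_def by blast+
  have \<phi>0: "\<phi> \<xi> = 0"
    using defining_function_frontier_zero[OF assms(1,2) gr] has_derivative_continuous[OF der]
    by (simp add: \<phi>_def)
  have \<psi>0: "\<psi> \<xi> = 0"
    using defining_function_frontier_zero[OF assms(1,2) gr'] has_derivative_continuous[OF der']
    by (simp add: \<psi>_def)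
  have N: "N \<noteq> 0" using defining_gradient_inner[OF r(2) der] by auto
  have N': "N' \<noteq> 0" using defining_gradient_inner[OF r'(2) der'] by auto
  show "norm N > 0" using N by simp
  show \<nu>1: "norm \<nu> = 1" using N' by (simp add: \<nu>)
  have "\<nu> = N /\<^sub>R norm N"
  proof (rule unit_vectors_eq_if_halfspace[OF \<nu>1])
    show "norm (N /\<^sub>R norm N) = 1" using N by simp
    fix h assume "\<nu> \<bullet> h < 0"
    then have neg: "N' \<bullet> h < 0" using N' by (simp add: \<nu> mult_less_0_iff)
    show "(N /\<^sub>R norm N) \<bullet> h \<le> 0"
    proof (rule ccontr)
      assume "\<not> (N /\<^sub>R norm N) \<bullet> h \<le> 0"
      then have pos: "N \<bullet> h > 0" using N by (simp add: zero_less_mult_iff not_le)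
      have D\<phi>: "((\<lambda>t. \<phi> (\<xi> + t *\<^sub>R h)) has_real_derivative N \<bullet> h) (at 0)"
        by (rule has_real_derivative_along_line) (use d\<phi> in simp)
      have D\<psi>: "((\<lambda>t. \<psi> (\<xi> + t *\<^sub>R h)) has_real_derivative N' \<bullet> h) (at 0)"
        by (rule has_real_derivative_along_line) (use d\<psi> in simp)
      obtain d1 where d1: "d1 > 0" "\<And>t. 0 < t \<Longrightarrow> t < d1 \<Longrightarrow> \<phi> (\<xi> + t *\<^sub>R h) > 0"
        using DERIV_pos_inc_right[OF D\<phi> pos] \<phi>0 by auto
      obtain d2 where d2: "d2 > 0" "\<And>t. 0 < t \<Longrightarrow> t < d2 \<Longrightarrow> \<psi> (\<xi> + t *\<^sub>R h) < 0"
        using DERIV_neg_dec_right[OF D\<psi> neg] \<psi>0 by auto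
      define d3 where "d3 = min r r' / (norm h + 1)"
      have nh: "norm h + 1 > 0" by (simp add: add_nonneg_pos)
      have d3: "d3 > 0" using r r' nh by (simp add: d3_def)
      define t where "t = min (min d1 d2) d3 / 2"
      have t: "0 < t" "t < d1" "t < d2" "t < d3" using d1 d2 d3 by (auto simp: t_def)
      have "t * norm h \<le> t * (norm h + 1)" using t by simp
      also have "\<dots> < min r r'" using t(4) nh by (simp add: d3_def less_divide_eq)
      finally have "\<xi> + t *\<^sub>R h \<in> ball \<xi> r" "\<xi> + t *\<^sub>R h \<in> ball \<xi> r'"
        using t by (auto simp: dist_norm)
      then show False using \<Omega> \<Omega>' d1(2)[of t] d2(2)[of t] t by (metis less_asym)
    qed
  qed
  then show "N = norm N *\<^sub>R \<nu>" using N by simp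
qed

text \<open>For \<open>x = \<xi> + h\<close> in the ball, \<open>norm (h + R \<nu>) < R\<close>
  means \<open>(norm h)\<^sup>2 + 2 R (\<nu> \<bullet> h) < 0\<close>. So the linear part of the
  defining function, \<open>n (\<nu> \<bullet> h)\<close>, outweighs the Taylor remainder
  \<open>C (norm h)\<^sup>2\<close> once \<open>2 R C < n\<close>.\<close>

lemma interior_ball:
  fixes \<Omega> :: "'a::euclidean_space set"
  assumes "open \<Omega>" "\<xi> \<in> frontier \<Omega>" "outer_unit_normal \<Omega> \<xi> \<nu>"
    and "C2_fun g" and gr: "bdry_graph g \<Omega> \<xi> e r"
  obtains R where "0 < R" "R \<le> 1" "ball (\<xi> - R *\<^sub>R \<nu>) R \<subseteq> \<Omega>" "norm \<nu> = 1"
proof -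
  obtain Gg where Gg: "\<And>x. (g has_derivative (\<lambda>h. Gg x \<bullet> h)) (at x)"
    and C1: "\<And>i. i \<in> Basis \<Longrightarrow> C1_fun (\<lambda>x. Gg x \<bullet> i)"
    using assms(4) unfolding C2_fun_def by blast
  define \<pi> where "\<pi> x = x - (x \<bullet> e) *\<^sub>R e" for x
  define \<phi> where "\<phi> x = x \<bullet> e - g (\<pi> x)" for x
  \<comment> \<open>This is the gradient of \<open>\<phi>\<close>: in the chain rule the orthogonal
    projection \<open>\<pi>\<close>, being self-adjoint, moves onto the gradient of
    \<open>g\<close>.\<close>
  define G where "G x = e - \<pi> (Gg (\<pi> x))" for x
  have d\<pi>: "(\<pi> has_derivative \<pi>) (at x)" for x
    unfolding \<pi>_def[abs_def] by (auto intro!: derivative_eq_intros)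
  have \<pi>sym: "\<pi> a \<bullet> b = a \<bullet> \<pi> b" for a b
    by (simp add: \<pi>_def inner_simps inner_commute)
  have d\<phi>: "(\<phi> has_derivative (\<lambda>h. G x \<bullet> h)) (at x)" for x
  proof -
    have "((\<lambda>x. g (\<pi> x)) has_derivative (\<lambda>h. Gg (\<pi> x) \<bullet> \<pi> h)) (at x)"
      by (rule has_derivative_compose[OF d\<pi> Gg])
    then have "((\<lambda>x. x \<bullet> e - g (\<pi> x)) has_derivative (\<lambda>h. h \<bullet> e - Gg (\<pi> x) \<bullet> \<pi> h)) (at x)"
      by (intro has_derivative_diff has_derivative_inner_left has_derivative_ident)
    then show ?thesis
      by (simp add: \<phi>_def[abs_def] G_def inner_diff_left inner_diff_right \<pi>sym inner_commute)
  qed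
  have "Gg differentiable (at x)" for x
    using C1 unfolding C1_fun_def
    by (subst differentiable_componentwise_within) (auto simp: differentiable_def)
  then obtain D where D: "(Gg has_derivative D) (at (\<pi> \<xi>))" unfolding differentiable_def by blast
  have "(G has_derivative (\<lambda>h. 0 - \<pi> (D (\<pi> h)))) (at \<xi>)"
    unfolding G_def[abs_def]
    by (rule has_derivative_diff[OF has_derivative_const
          has_derivative_compose[OF has_derivative_compose[OF d\<pi> D] d\<pi>]])
  then have Gdiff: "G differentiable (at \<xi>)" unfolding differentiable_def by blast
  obtain C q where q: "0 < q" "0 \<le> C"
    "\<And>h. norm h < q \<Longrightarrow> \<bar>\<phi> (\<xi> + h) - \<phi> \<xi> - G \<xi> \<bullet> h\<bar> \<le> C * (norm h)\<^sup>2"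
    using taylor_bound[OF open_UNIV UNIV_I d\<phi> Gdiff] by blast
  have der: "((\<lambda>x. x \<bullet> e - g (x - (x \<bullet> e) *\<^sub>R e)) has_derivative (\<lambda>h. G \<xi> \<bullet> h)) (at \<xi>)"
    using d\<phi>[of \<xi>] by (simp add: \<phi>_def[abs_def] \<pi>_def)
  note N = outer_normal_eq_normalized_gradient[OF assms(1-3) gr der]
  have \<phi>0: "\<phi> \<xi> = 0"
    using defining_function_frontier_zero[OF assms(1,2) gr] has_derivative_continuous[OF der]
    by (simp add: \<phi>_def \<pi>_def)
  have r: "r > 0" and \<Omega>: "\<And>x. x \<in> ball \<xi> r \<Longrightarrow> x \<in> \<Omega> \<longleftrightarrow> \<phi> x < 0"
    using bdry_graphD[OF gr] unfolding \<phi>_def \<pi>_def by blast+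
  define n where "n = norm (G \<xi>)"
  have n: "n > 0" using N(2) by (simp add: n_def)
  \<comment> \<open>Points of the ball satisfy \<open>norm h < 2 * R\<close>, so the graph
    description and the Taylor bound both apply. The last entry gives \<open>2 * R * C < n\<close>,
    with \<open>C + 1\<close> guarding against \<open>C = 0\<close>; the bound \<open>1\<close> is
    what \<open>barrier_comparison\<close> asks for.\<close>
  define R where "R = min 1 (min (min r q / 2) (n / (2 * (C + 1))))"
  have R: "0 < R" "R \<le> 1" "2 * R \<le> r" "2 * R \<le> q" and "R \<le> n / (2 * (C + 1))"
    using n q r by (auto simp: R_def)
  then have "2 * R * (C + 1) \<le> n" using q(2) by (simp add: pos_le_divide_eq mult_ac)
  then have RC: "2 * R * C < n" using R(1) by (simp add: algebra_simps)
  have "x \<in> \<Omega>" if x: "x \<in> ball (\<xi> - R *\<^sub>R \<nu>) R" for x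
  proof -
    define h where "h = x - \<xi>"
    have xh: "x = \<xi> + h" by (simp add: h_def)
    have nb: "norm (h + R *\<^sub>R \<nu>) < R"
      using x by (simp add: xh dist_norm norm_minus_commute add.commute)
    have "norm h \<le> norm (h + R *\<^sub>R \<nu>) + norm (R *\<^sub>R \<nu>)"
      by (metis add_diff_cancel_right' norm_triangle_ineq4)
    then have hR: "norm h < 2 * R" using nb N(3) R(1) by simp
    have "(norm (h + R *\<^sub>R \<nu>))\<^sup>2 < R\<^sup>2" using nb by (intro power_strict_mono) auto
    moreover have "(norm (h + R *\<^sub>R \<nu>))\<^sup>2 = (norm h)\<^sup>2 + 2 * R * (\<nu> \<bullet> h) + R\<^sup>2 * (norm \<nu>)\<^sup>2"
      unfolding power2_norm_eq_inner
      by (simp add: inner_simps inner_commute power2_eq_square algebra_simps)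
    ultimately have hn: "(norm h)\<^sup>2 + 2 * R * (\<nu> \<bullet> h) < 0" using N(3) by simp
    have "G \<xi> \<bullet> h = n * (\<nu> \<bullet> h)" using N(1) by (metis inner_scaleR_left n_def)
    then have "\<phi> x \<le> n * (\<nu> \<bullet> h) + C * (norm h)\<^sup>2"
      using q(3)[of h] hR R(4) \<phi>0 by (simp add: xh abs_le_iff)
    then have "2 * R * \<phi> x \<le> n * (2 * R * (\<nu> \<bullet> h)) + (2 * R * C) * (norm h)\<^sup>2"
      using R(1) mult_left_mono[of "\<phi> x" "n * (\<nu> \<bullet> h) + C * (norm h)\<^sup>2" "2 * R"]
      by (simp add: algebra_simps)
    also have "\<dots> \<le> n * (2 * R * (\<nu> \<bullet> h)) + n * (norm h)\<^sup>2"
      using RC by (intro add_left_mono mult_right_mono) auto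
    also have "\<dots> = n * ((norm h)\<^sup>2 + 2 * R * (\<nu> \<bullet> h))" by (simp add: algebra_simps)
    also have "\<dots> < 0" using hn n by (simp add: mult_pos_neg)
    finally have "\<phi> x < 0" using R(1) by (simp add: mult_less_0_iff)
    moreover have "x \<in> ball \<xi> r" using hR R(3) by (simp add: xh dist_norm)
    ultimately show ?thesis using \<Omega> by blast
  qed
  then show ?thesis using that[of R] R N(3) by blast
qed

section \<open>The one-sided normal derivative at the boundary point\<close>

theorem theorem2p9:
  fixes s :: real and \<Omega> :: "'a::euclidean_space set" and c0 \<epsilon> :: real
    and u :: "'a \<Rightarrow> real" and \<xi> \<nu> :: 'a
  assumes "0 < s" "s < 1"
    and "bounded \<Omega>" "open \<Omega>" "C1_boundary \<Omega>"
    and "0 < \<epsilon>" "\<epsilon> < 1"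
    and "continuous_on UNIV u" "bounded (range u)" "C2_closure u \<Omega>"
    and "\<forall>x\<in>\<Omega>. mixed_op s u x \<ge> 0"
    and "\<xi> \<in> frontier \<Omega>"
    and "\<forall>x\<in>ball \<xi> \<epsilon> \<inter> frontier \<Omega>. u x = c0"
    and "\<forall>x. u x \<ge> c0"
    and "\<exists>x. u x \<noteq> c0"
    and "C2_boundary_on \<Omega> (ball \<xi> \<epsilon> \<inter> frontier \<Omega>)"
    and "outer_unit_normal \<Omega> \<xi> \<nu>"
  shows "\<exists>L. ((\<lambda>t. (u \<xi> - u (\<xi> - t *\<^sub>R \<nu>)) / t) \<longlongrightarrow> L) (at_right 0) \<and> L < 0"
proof -
  have \<xi>: "\<xi> \<in> ball \<xi> \<epsilon> \<inter> frontier \<Omega>" using assms(6,12) by simp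
  then have u\<xi>: "u \<xi> = c0" using assms(13) by blast
  obtain g e r where "C2_fun g" "bdry_graph g \<Omega> \<xi> e r"
    using assms(16) \<xi> unfolding C2_boundary_on_def by blast
  then obtain R where R: "0 < R" "R \<le> 1" "ball (\<xi> - R *\<^sub>R \<nu>) R \<subseteq> \<Omega>" "norm \<nu> = 1"
    using interior_ball[OF assms(4,12,17)] by blast
  obtain z where z: "u z \<noteq> c0" using assms(15) by blast
  obtain \<delta> where \<delta>: "0 < \<delta>"
    "\<And>x. c0 + \<delta> * (R\<^sup>2 - (norm (x - (\<xi> - R *\<^sub>R \<nu>)))\<^sup>2) \<le> u x"
    using barrier_comparison[OF assms(1,2,4,8-10) _ _ z R(1-3)] assms(11,14) by metis
  obtain G H where G: "\<And>x. x \<in> \<Omega> \<Longrightarrow> (u has_derivative (\<lambda>h. G x \<bullet> h)) (at x)"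
    and Gc: "continuous_on (closure \<Omega>) G"
    using assms(10) unfolding C2_closure_def by blast
  have dist: "norm (\<xi> - t *\<^sub>R \<nu> - (\<xi> - R *\<^sub>R \<nu>)) = \<bar>R - t\<bar>" for t
  proof -
    have "\<xi> - t *\<^sub>R \<nu> - (\<xi> - R *\<^sub>R \<nu>) = (R - t) *\<^sub>R \<nu>" by (simp add: algebra_simps)
    then show ?thesis using R(4) by simp
  qed
  have mem: "\<xi> - t *\<^sub>R \<nu> \<in> \<Omega>" if "0 < t" "t < 2 * R" for t
    using R(3) dist[of t] that by (auto simp: subset_iff dist_norm norm_minus_commute abs_if)
  have ev: "eventually (\<lambda>t. t \<in> {0<..<2 * R}) (at_right 0)"
    using eventually_at_right_real[of 0 "2 * R"] R(1) by simp
  have path: "((\<lambda>t. \<xi> - t *\<^sub>R \<nu>) \<longlongrightarrow> \<xi>) (at_right 0)"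
    by (auto intro!: tendsto_eq_intros)
  \<comment> \<open>\<open>C2_closure\<close> gives derivatives of \<open>u\<close> in
    \<open>\<Omega>\<close> only, together with a continuous extension \<open>G\<close> of the
    gradient to the closure. L'Hopital's rule along the inward normal segment identifies the limit
    of the quotients at \<open>\<xi>\<close> with \<open>G \<xi> \<bullet> \<nu>\<close>.\<close>
  have lim: "((\<lambda>t. (u \<xi> - u (\<xi> - t *\<^sub>R \<nu>)) / t) \<longlongrightarrow> G \<xi> \<bullet> \<nu>) (at_right 0)"
  proof (rule lhopital_right_0[of "\<lambda>t. u \<xi> - u (\<xi> - t *\<^sub>R \<nu>)" "\<lambda>t. t" "\<lambda>_. 1"
        "\<lambda>t. G (\<xi> - t *\<^sub>R \<nu>) \<bullet> \<nu>"])
    have "isCont u \<xi>" using assms(8) by (simp add: continuous_on_eq_continuous_at)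
    from tendsto_diff[OF tendsto_const[of "u \<xi>"] isCont_tendsto_compose[OF this path]]
    show "((\<lambda>t. u \<xi> - u (\<xi> - t *\<^sub>R \<nu>)) \<longlongrightarrow> 0) (at_right 0)" by simp
    show "((\<lambda>t::real. t) \<longlongrightarrow> 0) (at_right 0)" by (rule tendsto_ident_at)
    show "eventually (\<lambda>t::real. t \<noteq> 0) (at_right 0)"
      using ev by eventually_elim auto
    show "eventually (\<lambda>t. ((\<lambda>t. u \<xi> - u (\<xi> - t *\<^sub>R \<nu>)) has_real_derivative G (\<xi> - t *\<^sub>R \<nu>) \<bullet> \<nu>) (at t)) (at_right 0)"
      using ev
    proof eventually_elim
      case (elim t)
      have "((\<lambda>t. u (\<xi> + t *\<^sub>R (- \<nu>))) has_real_derivative G (\<xi> - t *\<^sub>R \<nu>) \<bullet> (- \<nu>)) (at t)"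
        using G[OF mem[of t]] elim by (intro has_real_derivative_along_line) auto
      from DERIV_diff[OF DERIV_const[of "u \<xi>"] this] show ?case by simp
    qed
    have "filterlim (\<lambda>t. \<xi> - t *\<^sub>R \<nu>) (at \<xi> within closure \<Omega>) (at_right 0)"
    proof (subst filterlim_at, intro conjI)
      show "eventually (\<lambda>t. \<xi> - t *\<^sub>R \<nu> \<in> closure \<Omega> \<and> \<xi> - t *\<^sub>R \<nu> \<noteq> \<xi>) (at_right 0)"
        using ev
      proof eventually_elim
        case (elim t)
        then show ?case using mem[of t] R(4) closure_subset[of \<Omega>] by auto
      qed
    qed (rule path)
    moreover have "(G \<longlongrightarrow> G \<xi>) (at \<xi> within closure \<Omega>)"
      using Gc assms(12) by (auto simp: continuous_on_def frontier_def)
    ultimately have "((\<lambda>t. G (\<xi> - t *\<^sub>R \<nu>)) \<longlongrightarrow> G \<xi>) (at_right 0)"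
      using filterlim_compose by blast
    then show "((\<lambda>t. G (\<xi> - t *\<^sub>R \<nu>) \<bullet> \<nu> / 1) \<longlongrightarrow> G \<xi> \<bullet> \<nu>) (at_right 0)"
      using tendsto_inner[OF _ tendsto_const] by simp
  qed auto
  \<comment> \<open>At distance \<open>t\<close> along the inward normal the barrier equals
    \<open>c0 + \<delta> * (R\<^sup>2 - (R - t)\<^sup>2) = c0 + \<delta> * t * (2 * R - t)\<close>;
    dividing by \<open>t\<close> keeps the quotients away from \<open>0\<close> in the
    limit.\<close>
  have "G \<xi> \<bullet> \<nu> \<le> - (\<delta> * (2 * R - 0))"
  proof (rule tendsto_le[OF _ _ lim])
    show "((\<lambda>t. - (\<delta> * (2 * R - t))) \<longlongrightarrow> - (\<delta> * (2 * R - 0))) (at_right 0)"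
      by (intro tendsto_intros)
    show "eventually (\<lambda>t. (u \<xi> - u (\<xi> - t *\<^sub>R \<nu>)) / t \<le> - (\<delta> * (2 * R - t))) (at_right 0)"
      using ev
    proof eventually_elim
      case (elim t)
      have "u \<xi> - u (\<xi> - t *\<^sub>R \<nu>) \<le> - (\<delta> * (2 * R - t)) * t"
        using \<delta>(2)[of "\<xi> - t *\<^sub>R \<nu>"] u\<xi>
        unfolding dist power2_abs by (simp add: power2_eq_square algebra_simps)
      then show ?case using elim by (simp add: divide_le_eq)
    qed
  qed simp
  moreover have "\<delta> * (2 * R - 0) > 0" using \<delta>(1) R(1) by simp
  ultimately have "G \<xi> \<bullet> \<nu> < 0" by linarith
  then show ?thesis using lim by blast
qed

end
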